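(* Let $(X,p,q)$ be an interlaced space, with $w(x):=p(x,x)=q(x,x)$ and $d_{p,q}:=p-q$. Assume that $(X,d_{p,q})$ is Cauchy complete. Then $(X,\leq_{p,q})$ is conditionally monotone-complete, and the partial order $\leq_{p,q}$ is compatible with the topology induced by $d_{p,q}$. Moreover, if $(x_n)_n$ is a monotone net in $(X,\leq_{p,q})$, then the following conditions are equivalent: (1) $(x_n)_n$ converges; (2) $(x_n)_n$ has a supinf; (3) $\{x_n\}_n$ is bounded; (4) $\{w(x_n)\}_n$ is bounded.
   Context: A map $p:X\times X\to\mathbb{R}$ is submodular if $p(x,y)+p(z,z)\leqslant p(x,z)+p(z,y)$ for all $x,y,z\in X$, and symmetric if $p(x,y)=p(y,x)$ for all $x,y\in X$. A pseudo-interlaced space is a triplet $(X,p,q)$ where $X$ is a set and $p,q:X\times X\to\mathbb{R}$ are such that $p$ and $-q$ are symmetric and submodular, $w(x):=p(x,x)=q(x,x)$ for all $x$, and there is some $k>0$ with $w(x)+k\,q(x,y)\leqslant k\,p(x,y)+w(y)$ for all $x,y$. It is an interlaced space if moreover $p(x,y)=q(x,y)$ implies $x=y$, for all $x,y\in X$. The map $d_{p,q}(x,y)=p(x,y)-q(x,y)$ is then a metric on $X$. The relation $\leq_{p,q}$ is defined by: $x\leq_{p,q}y$ iff $w(x)\leqslant w(y)$ and, for all $z\in X$, $p(x,z)\leqslant p(y,z)$ and $q(x,z)\leqslant q(y,z)$ (equivalently, $w(x)\leqslant q(x,y)\leqslant p(x,y)\leqslant w(y)$); on an interlaced space it is a partial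 order. A net in a poset is monotone if it is non-decreasing or non-increasing. The supinf of a monotone net $(x_n)_n$, if it exists, is the supremum of $\{x_n\}_n$ if the net is non-decreasing and the infimum if it is non-increasing. A subset of a poset is bounded if it has both an upper bound and a lower bound. A poset is conditionally monotone-complete if every bounded monotone net has a supinf. A topology and a partial order on a set are compatible if, whenever $x$ is the supinf of a monotone net, the net converges to $x$.
   Formalization: The equivalence of (1)-(4) fails for general nets (min(n,0) over the integers converges but is unbounded below); it is proved with (3),(4) asked of a tail, and literally if the net has a lower bound (non-decreasing) or an upper bound (non-increasing); (3)=>(4)=>(1) and (1)<=>(2) always hold. *)

theory Defs
  imports "HOL-Analysis.Analysis" "HOL-Algebra.Order"
begin

section \<open>Interlaced spaces\<close>

definition submodular_on :: "'a set \<Rightarrow> ('a \<Rightarrow> 'a \<Rightarrow> real) \<Rightarrow> bool" where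
  "submodular_on X p \<longleftrightarrow> (\<forall>x\<in>X. \<forall>y\<in>X. \<forall>z\<in>X. p x y + p z z \<le> p x z + p z y)"

definition symmetric_on :: "'a set \<Rightarrow> ('a \<Rightarrow> 'a \<Rightarrow> real) \<Rightarrow> bool" where
  "symmetric_on X p \<longleftrightarrow> (\<forall>x\<in>X. \<forall>y\<in>X. p x y = p y x)"

definition weight :: "('a \<Rightarrow> 'a \<Rightarrow> real) \<Rightarrow> 'a \<Rightarrow> real" where
  "weight p x = p x x"

locale pseudo_interlaced_space =
  fixes X :: "'a set" and p q :: "'a \<Rightarrow> 'a \<Rightarrow> real"
  assumes p_symmetric: "symmetric_on X p"
    and p_submodular: "submodular_on X p"
    and q_symmetric: "symmetric_on X (\<lambda>x y. - q x y)"
    and q_submodular: "submodular_on X (\<lambda>x y. - q x y)"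
    and diagonal: "\<And>x. x \<in> X \<Longrightarrow> p x x = q x x"
    and weight_bound: "\<exists>k>0. \<forall>x\<in>X. \<forall>y\<in>X. weight p x + k * q x y \<le> k * p x y + weight p y"

locale interlaced_space = pseudo_interlaced_space +
  assumes separated: "\<And>x y. \<lbrakk>x \<in> X; y \<in> X; p x y = q x y\<rbrakk> \<Longrightarrow> x = y"

text \<open>
  The locale \<^locale>\<open>Metric_space\<close> asks for symmetry and nonnegativity on the whole type, whence the
  default value outside \<open>X\<close>.
\<close>
definition pq_dist :: "'a set \<Rightarrow> ('a \<Rightarrow> 'a \<Rightarrow> real) \<Rightarrow> ('a \<Rightarrow> 'a \<Rightarrow> real) \<Rightarrow> 'a \<Rightarrow> 'a \<Rightarrow> real" where
  "pq_dist X p q x y = (if x \<in> X \<and> y \<in> X then p x y - q x y else 0)"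

definition pq_order :: "'a set \<Rightarrow> ('a \<Rightarrow> 'a \<Rightarrow> real) \<Rightarrow> ('a \<Rightarrow> 'a \<Rightarrow> real) \<Rightarrow> 'a gorder" where
  "pq_order X p q =
    \<lparr>carrier = X, eq = (=),
     le = (\<lambda>x y. weight p x \<le> weight p y \<and> (\<forall>z\<in>X. p x z \<le> p y z \<and> q x z \<le> q y z))\<rparr>"

lemma (in interlaced_space) Metric_space_pq_dist: "Metric_space X (pq_dist X p q)"
proof
  show nonneg: "0 \<le> pq_dist X p q x y" for x y
  proof (cases "x \<in> X \<and> y \<in> X")
    case True
    then have "p x x + p y y \<le> p x y + p y x" "- q x x + - q y y \<le> - q x y + - q y x"
      using p_submodular q_submodular unfolding submodular_on_def by blast+
    moreover have "p x y = p y x" "q x y = q y x" "p x x = q x x" "p y y = q y y"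
      using True p_symmetric q_symmetric diagonal by (auto simp: symmetric_on_def)
    ultimately show ?thesis
      using True by (simp add: pq_dist_def)
  qed (auto simp: pq_dist_def)
  show "pq_dist X p q x y = pq_dist X p q y x" for x y
    using p_symmetric q_symmetric by (auto simp: pq_dist_def symmetric_on_def)
  show "pq_dist X p q x y = 0 \<longleftrightarrow> x = y" if "x \<in> X" "y \<in> X" for x y
    using that diagonal separated by (auto simp: pq_dist_def)
  show "pq_dist X p q x z \<le> pq_dist X p q x y + pq_dist X p q y z"
    if "x \<in> X" "y \<in> X" "z \<in> X" for x y z
  proof -
    have "p x z + p y y \<le> p x y + p y z" "- q x z + - q y y \<le> - q x y + - q y z"
      using p_submodular q_submodular that unfolding submodular_on_def by blast+
    then show ?thesis
      using that diagonal[of y] by (simp add: pq_dist_def)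
  qed
qed

lemma (in interlaced_space) partial_order_pq_order: "partial_order (pq_order X p q)"
proof
  fix x y
  assume xy: "x \<in> carrier (pq_order X p q)" "y \<in> carrier (pq_order X p q)"
    and le: "x \<sqsubseteq>\<^bsub>pq_order X p q\<^esub> y" "y \<sqsubseteq>\<^bsub>pq_order X p q\<^esub> x"
  have "x \<in> X" "y \<in> X"
    using xy by (auto simp: pq_order_def)
  moreover have "\<forall>z\<in>X. p x z = p y z \<and> q x z = q y z"
    using le by (simp add: pq_order_def order_eq_iff)
  ultimately have "p x y = q x y"
    using diagonal by simp
  with separated \<open>x \<in> X\<close> \<open>y \<in> X\<close> show "x .=\<^bsub>pq_order X p q\<^esub> y"
    by (simp add: pq_order_def)
next
  fix x y z
  assume xyz: "x \<sqsubseteq>\<^bsub>pq_order X p q\<^esub> y" "y \<sqsubseteq>\<^bsub>pq_order X p q\<^esub> z"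
  then show "x \<sqsubseteq>\<^bsub>pq_order X p q\<^esub> z"
    unfolding pq_order_def by (simp, meson order_trans)
qed (simp_all add: pq_order_def)

section \<open>Monotone nets\<close>

text \<open>
  A net is a function on a nonempty directed preordered set \<open>(I, r)\<close>.
\<close>
definition directed_set :: "'i set \<Rightarrow> ('i \<Rightarrow> 'i \<Rightarrow> bool) \<Rightarrow> bool" where
  "directed_set I r \<longleftrightarrow>
    I \<noteq> {} \<and> reflp_on I r \<and> transp_on I r \<and> (\<forall>i\<in>I. \<forall>j\<in>I. \<exists>k\<in>I. r i k \<and> r j k)"

definition net_filter :: "'i set \<Rightarrow> ('i \<Rightarrow> 'i \<Rightarrow> bool) \<Rightarrow> 'i filter" where
  "net_filter I r = (INF i\<in>I. principal {j \<in> I. r i j})"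

lemma eventually_net_filter:
  assumes "directed_set I r"
  shows "eventually P (net_filter I r) \<longleftrightarrow> (\<exists>i\<in>I. \<forall>j\<in>I. r i j \<longrightarrow> P j)"
proof -
  have "\<exists>k\<in>I. principal {l \<in> I. r k l} \<le> inf (principal {l \<in> I. r i l}) (principal {l \<in> I. r j l})"
    if ij: "i \<in> I" "j \<in> I" for i j
  proof -
    obtain k where "k \<in> I" "r i k" "r j k"
      using assms ij unfolding directed_set_def by blast
    moreover have "transp_on I r"
      using assms by (simp add: directed_set_def)
    ultimately show ?thesis
      using ij by (intro bexI[of _ k]) (auto dest: transp_onD)
  qed
  moreover have "I \<noteq> {}"
    using assms by (simp add: directed_set_def)
  ultimately show ?thesis
    unfolding net_filter_def by (subst eventually_INF_base) (auto simp: eventually_principal)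
qed

definition nondecreasing_net ::
    "'a gorder \<Rightarrow> 'i set \<Rightarrow> ('i \<Rightarrow> 'i \<Rightarrow> bool) \<Rightarrow> ('i \<Rightarrow> 'a) \<Rightarrow> bool" where
  "nondecreasing_net L I r x \<longleftrightarrow> monotone_on I r (\<lambda>a b. a \<sqsubseteq>\<^bsub>L\<^esub> b) x"

definition nonincreasing_net ::
    "'a gorder \<Rightarrow> 'i set \<Rightarrow> ('i \<Rightarrow> 'i \<Rightarrow> bool) \<Rightarrow> ('i \<Rightarrow> 'a) \<Rightarrow> bool" where
  "nonincreasing_net L I r x \<longleftrightarrow> monotone_on I r (\<lambda>a b. b \<sqsubseteq>\<^bsub>L\<^esub> a) x"

definition monotone_net ::
    "'a gorder \<Rightarrow> 'i set \<Rightarrow> ('i \<Rightarrow> 'i \<Rightarrow> bool) \<Rightarrow> ('i \<Rightarrow> 'a) \<Rightarrow> bool" where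
  "monotone_net L I r x \<longleftrightarrow>
    directed_set I r \<and> x ` I \<subseteq> carrier L \<and>
    (nondecreasing_net L I r x \<or> nonincreasing_net L I r x)"

text \<open>
  The two cases agree for a net that is both non-decreasing and non-increasing, since such a net is
  constant.
\<close>
definition is_supinf ::
    "'a gorder \<Rightarrow> 'i set \<Rightarrow> ('i \<Rightarrow> 'i \<Rightarrow> bool) \<Rightarrow> ('i \<Rightarrow> 'a) \<Rightarrow> 'a \<Rightarrow> bool" where
  "is_supinf L I r x s \<longleftrightarrow>
    (nondecreasing_net L I r x \<and> is_lub L s (x ` I)) \<or>
    (nonincreasing_net L I r x \<and> is_glb L s (x ` I))"

definition poset_bounded :: "'a gorder \<Rightarrow> 'a set \<Rightarrow> bool" where
  "poset_bounded L A \<longleftrightarrow> Upper L A \<noteq> {} \<and> Lower L A \<noteq> {}"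

text \<open>
  A definition cannot quantify over the types of index sets, so the next two notions take the type as
  an argument. A theorem with a free type variable \<open>'i\<close> in this position speaks about all nets.
\<close>
definition conditionally_monotone_complete :: "'i itself \<Rightarrow> 'a gorder \<Rightarrow> bool" where
  "conditionally_monotone_complete _ L \<longleftrightarrow>
    partial_order L \<and>
    (\<forall>(I :: 'i set) r x. monotone_net L I r x \<and> poset_bounded L (x ` I) \<longrightarrow>
      (\<exists>s. is_supinf L I r x s))"

definition compatible_topology :: "'i itself \<Rightarrow> 'a topology \<Rightarrow> 'a gorder \<Rightarrow> bool" where
  "compatible_topology _ T L \<longleftrightarrow>
    (\<forall>(I :: 'i set) r x s. monotone_net L I r x \<and> is_supinf L I r x s \<longrightarrow>
      limitin T x s (net_filter I r))"

section \<open>Bounds of tails\<close>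

text \<open>
  A convergent non-decreasing net always has an upper bound, but it may lack a lower bound: take
  \<open>min n 0\<close>, for \<open>n\<close> ranging over the directed set of all integers, in the real line
  (\<open>p = max\<close>, \<open>q = min\<close>). Hence, for nets over arbitrary directed sets, convergence can be
  equivalent to boundedness only if the latter is asked of a tail, or if the net is known to be
  bounded on the side it moves away from. The latter holds whenever the index set has a least element.
\<close>
definition tail :: "'i set \<Rightarrow> ('i \<Rightarrow> 'i \<Rightarrow> bool) \<Rightarrow> 'i \<Rightarrow> 'i set" where
  "tail I r i = {j \<in> I. r i j}"

definition bounded_at_start ::
    "'a gorder \<Rightarrow> 'i set \<Rightarrow> ('i \<Rightarrow> 'i \<Rightarrow> bool) \<Rightarrow> ('i \<Rightarrow> 'a) \<Rightarrow> bool" where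
  "bounded_at_start L I r x \<longleftrightarrow>
    (nondecreasing_net L I r x \<and> Lower L (x ` I) \<noteq> {}) \<or>
    (nonincreasing_net L I r x \<and> Upper L (x ` I) \<noteq> {})"

lemma bounded_at_start_if_least_index:
  assumes "monotone_net L I r x" and "i \<in> I" and "\<And>j. j \<in> I \<Longrightarrow> r i j"
  shows "bounded_at_start L I r x"
proof -
  have "x i \<in> carrier L"
    using assms by (auto simp: monotone_net_def)
  then have "x i \<in> Lower L (x ` I)" if "nondecreasing_net L I r x"
    using that assms by (auto simp: nondecreasing_net_def Lower_def dest: monotone_onD)
  moreover have "x i \<in> Upper L (x ` I)" if "nonincreasing_net L I r x"
    using that assms \<open>x i \<in> carrier L\<close>
    by (auto simp: nonincreasing_net_def Upper_def dest: monotone_onD)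
  ultimately show ?thesis
    using assms(1) unfolding monotone_net_def bounded_at_start_def by blast
qed

end

theory Submission
  imports Defs
begin

text \<open>
  If \<open>x \<le> y\<close>, then \<open>w x \<le> q x y \<le> p x y \<le> w y\<close>, whence \<open>d x y \<le> w y - w x\<close>: a non-decreasing net
  whose weights are bounded above is Cauchy. Conversely, submodularity and the weight bound make
  \<open>w\<close>, \<open>p\<close> and \<open>q\<close> Lipschitz with respect to \<open>d\<close>, so the order is closed and the limit of a
  non-decreasing net is its supremum. Replacing \<open>(p, q)\<close> by \<open>(-q, -p)\<close> keeps the metric and
  reverses the order, which settles non-increasing nets.
\<close>

section \<open>Nets and completeness in metric spaces\<close>

lemma net_filter_neq_bot:
  assumes "directed_set I r"
  shows "net_filter I r \<noteq> bot"
proof -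
  \<comment> \<open>By reflexivity every index lies in its own tail, so no tail is empty and
    \<open>False\<close> cannot hold eventually.\<close>
  have "I \<noteq> {}" "reflp_on I r"
    using assms by (auto simp: directed_set_def)
  then show ?thesis
    using eventually_net_filter[OF assms, of "\<lambda>_. False"]
    by (auto simp: trivial_limit_def dest: reflp_onD)
qed

text \<open>\<open>mcomplete\<close> speaks of sequences only. Choose indices \<open>f n\<close>
  beyond which the net stays within \<open>1 / (n + 1)\<close> of \<open>x (f n)\<close>. The
  sequence \<open>x \<circ> f\<close> is Cauchy because any two tails meet, and its limit attracts
  the whole net, although \<open>f\<close> need be neither monotone nor cofinal.\<close>

lemma (in Metric_space) mcomplete_Cauchy_net_converges:
  assumes "mcomplete" and dir: "directed_set I r" and x: "x ` I \<subseteq> M"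
    and Cauchy: "\<And>e. e > 0 \<Longrightarrow> \<exists>i\<in>I. \<forall>j\<in>I. r i j \<longrightarrow> d (x i) (x j) < e"
  shows "\<exists>l. limitin mtopology x l (net_filter I r)"
proof -
  have "\<forall>n::nat. \<exists>i\<in>I. \<forall>j\<in>I. r i j \<longrightarrow> d (x i) (x j) < inverse (Suc n)"
    using Cauchy by simp
  then obtain f where f: "\<And>n. f n \<in> I"
    and fd: "\<And>n j. j \<in> I \<Longrightarrow> r (f n) j \<Longrightarrow> d (x (f n)) (x j) < inverse (Suc n)"
    by metis
  have M: "x i \<in> M" if "i \<in> I" for i
    using that x by blast
  have bound: "d (x (f m)) (x (f n)) < inverse (Suc m) + inverse (Suc n)" for m n
  proof -
    \<comment> \<open>\<open>f m\<close> and \<open>f n\<close> may be incomparable; a common later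
      index \<open>k\<close> links the two points through \<open>x k\<close>.\<close>
    obtain k where k: "k \<in> I" "r (f m) k" "r (f n) k"
      using dir f unfolding directed_set_def by meson
    have "d (x (f m)) (x (f n)) \<le> d (x (f m)) (x k) + d (x k) (x (f n))"
      using triangle M f k by blast
    then show ?thesis
      using fd[of k m] fd[of k n] k commute[of "x k" "x (f n)"] by linarith
  qed
  have "MCauchy (x \<circ> f)"
    unfolding MCauchy_def
  proof (intro conjI allI impI)
    show "range (x \<circ> f) \<subseteq> M"
      using f x by auto
    fix e :: real
    assume "e > 0"
    then obtain N where N: "inverse (Suc N) < e / 2"
      using reals_Archimedean[of "e / 2"] by auto
    have "d ((x \<circ> f) m) ((x \<circ> f) n) < e" if "N \<le> m" "N \<le> n" for m n
    proof -
      have "inverse (real (Suc m)) \<le> inverse (Suc N)" "inverse (real (Suc n)) \<le> inverse (Suc N)"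
        using that by (auto intro!: le_imp_inverse_le)
      then show ?thesis
        using bound[of m n] N unfolding comp_def by linarith
    qed
    then show "\<exists>N. \<forall>n n'. N \<le> n \<longrightarrow> N \<le> n' \<longrightarrow> d ((x \<circ> f) n) ((x \<circ> f) n') < e"
      by blast
  qed
  then obtain l where l: "limitin mtopology (x \<circ> f) l sequentially"
    using \<open>mcomplete\<close> unfolding mcomplete_def by blast
  have "limitin mtopology x l (net_filter I r)"
    unfolding limitin_metric
  proof (intro conjI allI impI)
    show lM: "l \<in> M"
      using l by (simp add: limitin_metric)
    fix e :: real
    assume "e > 0"
    \<comment> \<open>A single \<open>n\<close> has to bring \<open>x (f n)\<close> within
      \<open>e / 2\<close> of \<open>l\<close> and also make the radius of the tail beyond
      \<open>f n\<close> smaller than \<open>e / 2\<close>.\<close>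
    have "\<forall>\<^sub>F n in sequentially. d (x (f n)) l < e / 2"
      using l \<open>e > 0\<close> unfolding limitin_metric
      by (auto elim!: allE[of _ "e / 2"] eventually_mono)
    moreover have "\<forall>\<^sub>F n in sequentially. inverse (real (Suc n)) < e / 2"
      by (rule order_tendstoD(2)[OF LIMSEQ_inverse_real_of_nat half_gt_zero[OF \<open>e > 0\<close>]])
    ultimately have "\<forall>\<^sub>F n in sequentially. d (x (f n)) l < e / 2 \<and> inverse (real (Suc n)) < e / 2"
      by (rule eventually_conj)
    from eventually_happens'[OF sequentially_bot this] obtain n where n: "d (x (f n)) l < e / 2" "inverse (real (Suc n)) < e / 2"
      by blast
    have "x j \<in> M \<and> d (x j) l < e" if "j \<in> I" "r (f n) j" for j
      using triangle[of "x j" "x (f n)" l] M[OF f] M[OF that(1)] lM fd[OF that] n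
        commute[of "x j" "x (f n)"] that by auto
    then show "\<forall>\<^sub>F j in net_filter I r. x j \<in> M \<and> d (x j) l < e"
      using f by (auto simp: eventually_net_filter[OF dir])
  qed
  then show ?thesis ..
qed

lemma (in Metric_space) tendsto_Lipschitz:
  assumes "limitin mtopology x l F"
    and lip: "\<And>a b. a \<in> M \<Longrightarrow> b \<in> M \<Longrightarrow> \<bar>f a - f b\<bar> \<le> C * d a b"
  shows "((\<lambda>i. f (x i)) \<longlongrightarrow> (f l :: real)) F"
proof (rule tendstoI)
  fix e :: real
  assume "e > 0"
  \<comment> \<open>\<open>C\<close> comes without a sign; \<open>\<bar>C\<bar> + 1\<close> is a
    positive number above it by which one can divide.\<close>
  then have "e / (\<bar>C\<bar> + 1) > 0"
    by simp
  then have ev: "\<forall>\<^sub>F i in F. x i \<in> M \<and> d (x i) l < e / (\<bar>C\<bar> + 1)" and l: "l \<in> M"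
    using assms(1) unfolding limitin_metric by blast+
  have "dist (f a) (f l) < e" if "a \<in> M" "d a l < e / (\<bar>C\<bar> + 1)" for a
  proof -
    have "dist (f a) (f l) \<le> C * d a l"
      using lip that l by (simp add: dist_real_def)
    also have "\<dots> \<le> (\<bar>C\<bar> + 1) * d a l"
      by (intro mult_right_mono) auto
    also have "\<dots> < e"
      using that(2) by (simp add: pos_less_divide_eq mult.commute add_nonneg_pos)
    finally show ?thesis .
  qed
  with ev show "\<forall>\<^sub>F i in F. dist (f (x i)) (f l) < e"
    by (auto elim: eventually_mono)
qed

section \<open>Metric and order of an interlaced space\<close>

lemma carrier_pq_order [simp]: "carrier (pq_order X p q) = X"
  by (simp add: pq_order_def)

lemma le_pq_order:
  "x \<sqsubseteq>\<^bsub>pq_order X p q\<^esub> y \<longleftrightarrow>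
    weight p x \<le> weight p y \<and> (\<forall>z\<in>X. p x z \<le> p y z \<and> q x z \<le> q y z)"
  by (simp add: pq_order_def)

text \<open>As an equation between functions it rewrites the topology and the completeness of the
  dual space to those of the original one.\<close>

lemma pq_dist_dual: "pq_dist X (\<lambda>x y. - q x y) (\<lambda>x y. - p x y) = pq_dist X p q"
  by (auto simp: pq_dist_def fun_eq_iff)

context interlaced_space
begin

abbreviation "L \<equiv> pq_order X p q"

sublocale metric: Metric_space X "pq_dist X p q"
  by (rule Metric_space_pq_dist)

lemma pq_sym: "x \<in> X \<Longrightarrow> y \<in> X \<Longrightarrow> p x y = p y x" "x \<in> X \<Longrightarrow> y \<in> X \<Longrightarrow> q x y = q y x"
  using p_symmetric q_symmetric by (auto simp: symmetric_on_def)

lemma submod: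
  assumes "x \<in> X" "y \<in> X" "z \<in> X"
  shows "p x y + p z z \<le> p x z + p z y" "q x z + q z y \<le> q x y + q z z"
proof -
  show "p x y + p z z \<le> p x z + p z y"
    using p_submodular assms by (simp add: submodular_on_def)
  have "- q x y + - q z z \<le> - q x z + - q z y"
    using q_submodular assms unfolding submodular_on_def by blast
  then show "q x z + q z y \<le> q x y + q z z"
    by simp
qed

text \<open>All bounds are proved one-sidedly first; the symmetry of the distance then yields the
  absolute values.\<close>

lemma Lipschitz:
  obtains k where "\<And>a b. a \<in> X \<Longrightarrow> b \<in> X \<Longrightarrow> \<bar>weight p a - weight p b\<bar> \<le> k * pq_dist X p q a b"
    and "\<And>a b z. a \<in> X \<Longrightarrow> b \<in> X \<Longrightarrow> z \<in> X \<Longrightarrow> \<bar>p a z - p b z\<bar> \<le> (1 + k / 2) * pq_dist X p q a b"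
    and "\<And>a b z. a \<in> X \<Longrightarrow> b \<in> X \<Longrightarrow> z \<in> X \<Longrightarrow> \<bar>q a z - q b z\<bar> \<le> (1 + k / 2) * pq_dist X p q a b"
proof -
  obtain k where k: "\<forall>x\<in>X. \<forall>y\<in>X. weight p x + k * q x y \<le> k * p x y + weight p y"
    using weight_bound by blast
  have w: "weight p a - weight p b \<le> k * pq_dist X p q a b" if "a \<in> X" "b \<in> X" for a b
  proof -
    have "weight p a + k * q a b \<le> k * p a b + weight p b"
      using k that by blast
    then show ?thesis
      using that by (simp add: pq_dist_def right_diff_distrib)
  qed
  \<comment> \<open>Submodularity through \<open>b\<close> bounds the first difference by
    \<open>p a b - p b b\<close>, which is the distance plus \<open>q a b - p b b\<close>. As
    \<open>2 * q a b \<le> q a a + q b b\<close>, the excess is at most half the difference of the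
    weights, hence at most \<open>k / 2\<close> times the distance. The argument for
    \<open>q\<close> is the mirror image, with \<open>p a a + p b b \<le> 2 * p a b\<close>.\<close>
  have pq: "p a z - p b z \<le> (1 + k / 2) * pq_dist X p q a b"
    "q a z - q b z \<le> (1 + k / 2) * pq_dist X p q a b"
    if "a \<in> X" "b \<in> X" "z \<in> X" for a b z
  proof -
    have "p a z - p b z \<le> p a b - p b b"
      using submod(1)[of a z b] that by simp
    moreover have "2 * q a b \<le> q a a + q b b"
      using submod(2)[of a a b] pq_sym that by simp
    moreover have "q a z - q b z \<le> q a a - q a b"
      using submod(2)[of b z a] pq_sym that by simp
    moreover have "p a a + p b b \<le> 2 * p a b"
      using submod(1)[of a a b] pq_sym that by simp
    ultimately show "p a z - p b z \<le> (1 + k / 2) * pq_dist X p q a b"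
      "q a z - q b z \<le> (1 + k / 2) * pq_dist X p q a b"
      using w[OF that(1,2)] diagonal[OF that(1)] diagonal[OF that(2)] that
      by (simp_all add: weight_def pq_dist_def algebra_simps)
  qed
  show thesis
  proof (rule that)
    fix a b
    assume ab: "a \<in> X" "b \<in> X"
    show "\<bar>weight p a - weight p b\<bar> \<le> k * pq_dist X p q a b"
      using w[of a b] w[of b a] ab metric.commute[of a b] by (simp add: abs_le_iff)
    fix z
    assume "z \<in> X"
    then show "\<bar>p a z - p b z\<bar> \<le> (1 + k / 2) * pq_dist X p q a b"
      "\<bar>q a z - q b z\<bar> \<le> (1 + k / 2) * pq_dist X p q a b"
      using pq[of a b z] pq[of b a z] ab metric.commute[of a b] by (simp_all add: abs_le_iff)
  qed
qed

lemma limit_tendsto: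
  assumes "limitin metric.mtopology x l F"
  shows "((\<lambda>i. weight p (x i)) \<longlongrightarrow> weight p l) F"
    and "z \<in> X \<Longrightarrow> ((\<lambda>i. p (x i) z) \<longlongrightarrow> p l z) F"
    and "z \<in> X \<Longrightarrow> ((\<lambda>i. q (x i) z) \<longlongrightarrow> q l z) F"
proof -
  obtain k where k:
    "\<And>a b. a \<in> X \<Longrightarrow> b \<in> X \<Longrightarrow> \<bar>weight p a - weight p b\<bar> \<le> k * pq_dist X p q a b"
    "\<And>a b z. a \<in> X \<Longrightarrow> b \<in> X \<Longrightarrow> z \<in> X \<Longrightarrow> \<bar>p a z - p b z\<bar> \<le> (1 + k / 2) * pq_dist X p q a b"
    "\<And>a b z. a \<in> X \<Longrightarrow> b \<in> X \<Longrightarrow> z \<in> X \<Longrightarrow> \<bar>q a z - q b z\<bar> \<le> (1 + k / 2) * pq_dist X p q a b"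
    using Lipschitz by blast
  show "((\<lambda>i. weight p (x i)) \<longlongrightarrow> weight p l) F"
    using metric.tendsto_Lipschitz[OF assms k(1)] .
  show "((\<lambda>i. p (x i) z) \<longlongrightarrow> p l z) F" if "z \<in> X"
    using metric.tendsto_Lipschitz[OF assms, of "\<lambda>y. p y z"] k(2) that by blast
  show "((\<lambda>i. q (x i) z) \<longlongrightarrow> q l z) F" if "z \<in> X"
    using metric.tendsto_Lipschitz[OF assms, of "\<lambda>y. q y z"] k(3) that by blast
qed

text \<open>The order is a family of non-strict inequalities between functions continuous for the
  metric, and these survive limits along a nontrivial filter.\<close>

lemma limit_ge:
  assumes "limitin metric.mtopology x l F" "F \<noteq> bot" "\<forall>\<^sub>F i in F. y \<sqsubseteq>\<^bsub>L\<^esub> x i"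
  shows "y \<sqsubseteq>\<^bsub>L\<^esub> l"
  unfolding le_pq_order
proof (intro conjI ballI)
  note lim = limit_tendsto[OF assms(1)]
  show "weight p y \<le> weight p l"
    using assms(3) by (intro tendsto_lowerbound[OF lim(1) _ assms(2)])
      (auto simp: le_pq_order elim: eventually_mono)
  fix z
  assume z: "z \<in> X"
  show "p y z \<le> p l z"
    using assms(3) z by (intro tendsto_lowerbound[OF lim(2) _ assms(2)])
      (auto simp: le_pq_order elim: eventually_mono)
  show "q y z \<le> q l z"
    using assms(3) z by (intro tendsto_lowerbound[OF lim(3) _ assms(2)])
      (auto simp: le_pq_order elim: eventually_mono)
qed

lemma limit_le:
  assumes "limitin metric.mtopology x l F" "F \<noteq> bot" "\<forall>\<^sub>F i in F. x i \<sqsubseteq>\<^bsub>L\<^esub> y"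
  shows "l \<sqsubseteq>\<^bsub>L\<^esub> y"
  unfolding le_pq_order
proof (intro conjI ballI)
  note lim = limit_tendsto[OF assms(1)]
  show "weight p l \<le> weight p y"
    using assms(3) by (intro tendsto_upperbound[OF lim(1) _ assms(2)])
      (auto simp: le_pq_order elim: eventually_mono)
  fix z
  assume z: "z \<in> X"
  show "p l z \<le> p y z"
    using assms(3) z by (intro tendsto_upperbound[OF lim(2) _ assms(2)])
      (auto simp: le_pq_order elim: eventually_mono)
  show "q l z \<le> q y z"
    using assms(3) z by (intro tendsto_upperbound[OF lim(3) _ assms(2)])
      (auto simp: le_pq_order elim: eventually_mono)
qed

lemma pq_dist_le_weight_diff:
  assumes "x \<in> X" "y \<in> X" "x \<sqsubseteq>\<^bsub>L\<^esub> y"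
  shows "pq_dist X p q x y \<le> weight p y - weight p x"
proof -
  \<comment> \<open>The order is tested at \<open>z = y\<close> for \<open>p\<close> and at
    \<open>z = x\<close> for \<open>q\<close>.\<close>
  have "p x y \<le> p y y" "q x x \<le> q y x"
    using assms by (auto simp: le_pq_order)
  then show ?thesis
    using assms diagonal[of x] pq_sym(2)[of x y] by (simp add: pq_dist_def weight_def)
qed

section \<open>Non-decreasing nets\<close>

lemma nondecreasing_limit_is_lub:
  assumes "directed_set I r" "x ` I \<subseteq> X" "nondecreasing_net L I r x"
    and lim: "limitin metric.mtopology x l (net_filter I r)"
  shows "is_lub L l (x ` I)"
proof -
  note nbot = net_filter_neq_bot[OF assms(1)]
  have l: "l \<in> X"
    using lim by (simp add: metric.limitin_metric)
  \<comment> \<open>Monotonicity puts \<open>x i\<close> below every term from index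
    \<open>i\<close> on, which is all that \<open>limit_ge\<close> asks.\<close>
  have "x i \<sqsubseteq>\<^bsub>L\<^esub> l" if "i \<in> I" for i
    using assms(3) that
    by (intro limit_ge[OF lim nbot])
      (auto simp: nondecreasing_net_def eventually_net_filter[OF assms(1)] dest: monotone_onD)
  moreover have "l \<sqsubseteq>\<^bsub>L\<^esub> u" if "u \<in> Upper L (x ` I)" for u
  proof (rule limit_le[OF lim nbot])
    have "I \<noteq> {}" "\<forall>i\<in>I. x i \<sqsubseteq>\<^bsub>L\<^esub> u"
      using that assms(1,2) by (auto simp: directed_set_def Upper_def)
    then show "\<forall>\<^sub>F i in net_filter I r. x i \<sqsubseteq>\<^bsub>L\<^esub> u"
      unfolding eventually_net_filter[OF assms(1)] by blast
  qed
  ultimately show ?thesis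
    using l by (auto simp: least_def Upper_def)
qed

text \<open>Pick \<open>j\<close> in the tail with weight within \<open>e\<close> of the supremum of
  the weights there. All later weights lie between that of \<open>x j\<close> and the supremum, and
  a difference of weights dominates the distance of comparable points.\<close>

lemma nondecreasing_bdd_weights_converges:
  assumes "metric.mcomplete" "directed_set I r" "x ` I \<subseteq> X" "nondecreasing_net L I r x"
    and "i \<in> I" and bdd: "bdd_above (weight p ` x ` tail I r i)"
  shows "\<exists>l. limitin metric.mtopology x l (net_filter I r)"
proof (rule metric.mcomplete_Cauchy_net_converges[OF assms(1-3)])
  fix e :: real
  assume "e > 0"
  let ?W = "weight p ` x ` tail I r i"
  have "i \<in> tail I r i"
    using assms(2,5) by (auto simp: tail_def directed_set_def dest: reflp_onD)
  then have "?W \<noteq> {}" "Sup ?W - e < Sup ?W"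
    using \<open>e > 0\<close> by auto
  then have "\<exists>v\<in>?W. Sup ?W - e < v"
    by (rule less_cSupD)
  then obtain j where j: "j \<in> tail I r i" "Sup ?W - e < weight p (x j)"
    by blast
  have "pq_dist X p q (x j) (x m) < e" if m: "m \<in> I" "r j m" for m
  proof -
    have jI: "j \<in> I" "r i j"
      using j by (auto simp: tail_def)
    have "transp_on I r"
      using assms(2) by (simp add: directed_set_def)
    \<comment> \<open>The supremum ranges over the tail from \<open>i\<close> only, so
      \<open>m\<close> has to be placed in that tail.\<close>
    then have "r i m"
      using transp_onD[of I r i j m] assms(5) jI m by simp
    then have "weight p (x m) \<le> Sup ?W"
      using m by (intro cSup_upper bdd) (auto simp: tail_def)
    moreover have "x j \<sqsubseteq>\<^bsub>L\<^esub> x m"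
      using assms(4) jI m by (auto simp: nondecreasing_net_def dest: monotone_onD)
    then have "pq_dist X p q (x j) (x m) \<le> weight p (x m) - weight p (x j)"
      using assms(3) jI m by (intro pq_dist_le_weight_diff) auto
    ultimately show ?thesis
      using j by linarith
  qed
  moreover have "j \<in> I"
    using j by (simp add: tail_def)
  ultimately show "\<exists>j\<in>I. \<forall>m\<in>I. r j m \<longrightarrow> pq_dist X p q (x j) (x m) < e"
    by blast
qed

text \<open>The supremum is used first only to bound the weights. Completeness then provides some
  limit, which is itself a supremum, and suprema in a partial order are unique.\<close>

lemma nondecreasing_lub_is_limit:
  assumes "metric.mcomplete" "directed_set I r" "x ` I \<subseteq> X" "nondecreasing_net L I r x"
    and lub: "is_lub L s (x ` I)"
  shows "limitin metric.mtopology x s (net_filter I r)"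
proof -
  interpret partial_order L
    by (rule partial_order_pq_order)
  obtain i where i: "i \<in> I"
    using assms(2) by (auto simp: directed_set_def)
  have "weight p (x j) \<le> weight p s" if "j \<in> I" for j
    using lub assms(3) that by (auto simp: least_def Upper_def le_pq_order)
  then have "bdd_above (weight p ` x ` tail I r i)"
    by (auto simp: bdd_above_def tail_def)
  from nondecreasing_bdd_weights_converges[OF assms(1-4) i this]
  obtain l where l: "limitin metric.mtopology x l (net_filter I r)" ..
  moreover have "l = s"
    by (rule least_unique[OF nondecreasing_limit_is_lub[OF assms(2-4) l] lub])
  ultimately show ?thesis
    by simp
qed

section \<open>Duality and non-increasing nets\<close>

lemma interlaced_space_dual: "interlaced_space X (\<lambda>x y. - q x y) (\<lambda>x y. - p x y)"
proof (unfold_locales)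
  obtain k where "k > 0" "\<forall>x\<in>X. \<forall>y\<in>X. weight p x + k * q x y \<le> k * p x y + weight p y"
    using weight_bound by blast
  \<comment> \<open>The weight changes sign, so the dual bound at \<open>(x, y)\<close> is the
    original one at \<open>(y, x)\<close>, with the same \<open>k\<close>.\<close>
  then show "\<exists>k>0. \<forall>x\<in>X. \<forall>y\<in>X. weight (\<lambda>x y. - q x y) x + k * - p x y
      \<le> k * - q x y + weight (\<lambda>x y. - q x y) y"
    by (intro exI[of _ k]) (force simp: weight_def diagonal pq_sym)
qed (use p_symmetric p_submodular q_symmetric q_submodular diagonal separated in auto)

abbreviation "L_dual \<equiv> pq_order X (\<lambda>x y. - q x y) (\<lambda>x y. - p x y)"

text \<open>The dual weight is \<open>- q x x\<close>, which the diagonal condition identifies with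
  the negated weight only for points of \<open>X\<close>.\<close>

lemma le_dual: "x \<in> X \<Longrightarrow> y \<in> X \<Longrightarrow> x \<sqsubseteq>\<^bsub>L_dual\<^esub> y \<longleftrightarrow> y \<sqsubseteq>\<^bsub>L\<^esub> x"
  by (auto simp: le_pq_order weight_def diagonal)

lemma is_lub_dual: "is_lub L_dual s A \<longleftrightarrow> is_glb L s A"
proof -
  \<comment> \<open>\<open>Upper\<close> and \<open>Lower\<close> test only the members of
    \<open>A\<close> inside the carrier, where \<open>le_dual\<close> applies.\<close>
  have "Upper L_dual A = Lower L A"
    using le_dual by (auto simp: Upper_def Lower_def)
  then show ?thesis
    using le_dual Lower_closed[of L A] by (auto simp: least_def greatest_def subset_iff)
qed

lemma nondecreasing_net_dual:
  "x ` I \<subseteq> X \<Longrightarrow> nondecreasing_net L_dual I r x \<longleftrightarrow> nonincreasing_net L I r x"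
  using le_dual by (auto simp: nondecreasing_net_def nonincreasing_net_def monotone_on_def image_subset_iff)

lemma nonincreasing_limit_is_glb:
  assumes "directed_set I r" "x ` I \<subseteq> X" "nonincreasing_net L I r x"
    and "limitin metric.mtopology x l (net_filter I r)"
  shows "is_glb L l (x ` I)"
  using interlaced_space.nondecreasing_limit_is_lub[OF interlaced_space_dual assms(1,2)] assms
  by (simp add: pq_dist_dual is_lub_dual nondecreasing_net_dual)

lemma nonincreasing_bdd_weights_converges:
  assumes "metric.mcomplete" "directed_set I r" "x ` I \<subseteq> X" "nonincreasing_net L I r x"
    and "i \<in> I" and "bdd_below (weight p ` x ` tail I r i)"
  shows "\<exists>l. limitin metric.mtopology x l (net_filter I r)"
proof -
  \<comment> \<open>Negation turns the lower bound on the weights into the upper bound that the dual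
    statement wants.\<close>
  have "weight (\<lambda>x y. - q x y) ` x ` tail I r i = uminus ` weight p ` x ` tail I r i"
    using assms(3) diagonal by (force simp: weight_def tail_def image_def)
  then have "bdd_above (weight (\<lambda>x y. - q x y) ` x ` tail I r i)"
    using assms(6) by simp
  then show ?thesis
    using interlaced_space.nondecreasing_bdd_weights_converges[OF interlaced_space_dual _ assms(2,3)]
      assms
    by (simp add: pq_dist_dual nondecreasing_net_dual)
qed

lemma nonincreasing_glb_is_limit:
  assumes "metric.mcomplete" "directed_set I r" "x ` I \<subseteq> X" "nonincreasing_net L I r x"
    and "is_glb L s (x ` I)"
  shows "limitin metric.mtopology x s (net_filter I r)"
  using interlaced_space.nondecreasing_lub_is_limit[OF interlaced_space_dual _ assms(2,3)] assms
  by (simp add: pq_dist_dual is_lub_dual nondecreasing_net_dual)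

section \<open>Supinf, convergence and boundedness of monotone nets\<close>

text \<open>Stated for a given \<open>s\<close>, this yields both the compatibility of order and
  topology and the equivalence of convergence with having a supinf.\<close>

lemma supinf_iff_limit:
  assumes "metric.mcomplete" "monotone_net L I r x"
  shows "is_supinf L I r x s \<longleftrightarrow> limitin metric.mtopology x s (net_filter I r)"
  using assms nondecreasing_lub_is_limit[of I r x s] nonincreasing_glb_is_limit[of I r x s]
    nondecreasing_limit_is_lub[of I r x s] nonincreasing_limit_is_glb[of I r x s]
  by (auto simp: monotone_net_def is_supinf_def)

text \<open>Any tail will do: the limit bounds it on one side and its first term on the
  other.\<close>

lemma bounded_tail_if_converges:
  assumes net: "monotone_net L I r x"
    and lim: "limitin metric.mtopology x l (net_filter I r)"
  shows "\<exists>i\<in>I. poset_bounded L (x ` tail I r i)"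
proof -
  have d: "directed_set I r" "x ` I \<subseteq> X"
    using net by (auto simp: monotone_net_def)
  then obtain i where i: "i \<in> I"
    by (auto simp: directed_set_def)
  have X: "x i \<in> X" "l \<in> X"
    using i d lim by (auto simp: metric.limitin_metric)
  consider "nondecreasing_net L I r x" | "nonincreasing_net L I r x"
    using net by (auto simp: monotone_net_def)
  then have "poset_bounded L (x ` tail I r i)"
  proof cases
    case 1
    then have "l \<in> Upper L (x ` tail I r i)" "x i \<in> Lower L (x ` tail I r i)"
      using nondecreasing_limit_is_lub[OF d 1 lim] i X
      by (auto simp: least_def Upper_def Lower_def tail_def nondecreasing_net_def dest: monotone_onD)
    then show ?thesis
      by (auto simp: poset_bounded_def)
  next
    case 2
    then have "l \<in> Lower L (x ` tail I r i)" "x i \<in> Upper L (x ` tail I r i)"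
      using nonincreasing_limit_is_glb[OF d 2 lim] i X
      by (auto simp: greatest_def Upper_def Lower_def tail_def nonincreasing_net_def dest: monotone_onD)
    then show ?thesis
      by (auto simp: poset_bounded_def)
  qed
  with i show ?thesis ..
qed

lemma bounded_weights_if_poset_bounded:
  assumes "A \<subseteq> X" "poset_bounded L A"
  shows "bounded (weight p ` A)"
proof -
  obtain u l where "u \<in> Upper L A" "l \<in> Lower L A"
    using assms(2) by (auto simp: poset_bounded_def)
  then have "weight p a \<in> {weight p l..weight p u}" if "a \<in> A" for a
    using that assms(1) by (auto simp: Upper_def Lower_def le_pq_order)
  then show ?thesis
    by (intro bounded_subset[OF bounded_closed_interval]) blast
qed

lemma converges_if_bounded_tail_weights:
  assumes "metric.mcomplete" "monotone_net L I r x" "i \<in> I" "bounded (weight p ` x ` tail I r i)"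
  shows "\<exists>l. limitin metric.mtopology x l (net_filter I r)"
proof -
  have "directed_set I r" "x ` I \<subseteq> X"
    using assms(2) by (auto simp: monotone_net_def)
  note nets = assms(1) this
  consider "nondecreasing_net L I r x" | "nonincreasing_net L I r x"
    using assms(2) by (auto simp: monotone_net_def)
  then show ?thesis
  proof cases
    case 1
    show ?thesis
      by (rule nondecreasing_bdd_weights_converges[OF nets 1 assms(3)])
        (rule bounded_imp_bdd_above[OF assms(4)])
  next
    case 2
    show ?thesis
      by (rule nonincreasing_bdd_weights_converges[OF nets 2 assms(3)])
        (rule bounded_imp_bdd_below[OF assms(4)])
  qed
qed

text \<open>The limit bounds the net on the side it moves towards; \<open>bounded_at_start\<close>
  supplies the other bound.\<close>

lemma poset_bounded_if_converges:
  assumes "monotone_net L I r x" "limitin metric.mtopology x l (net_filter I r)"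
    and "bounded_at_start L I r x"
  shows "poset_bounded L (x ` I)"
  using assms nondecreasing_limit_is_lub[of I r x l] nonincreasing_limit_is_glb[of I r x l]
  by (auto simp: bounded_at_start_def poset_bounded_def monotone_net_def least_def greatest_def)

lemma converges_if_bounded_weights:
  assumes "metric.mcomplete" "monotone_net L I r x" "bounded (weight p ` x ` I)"
  shows "\<exists>l. limitin metric.mtopology x l (net_filter I r)"
proof -
  obtain i where i: "i \<in> I"
    using assms(2) by (auto simp: monotone_net_def directed_set_def)
  have "bounded (weight p ` x ` tail I r i)"
    using assms(3) by (rule bounded_subset) (auto simp: tail_def)
  then show ?thesis
    by (rule converges_if_bounded_tail_weights[OF assms(1,2) i])
qed

end

theorem theorem4p12:
  fixes X :: "'a set" and p q :: "'a \<Rightarrow> 'a \<Rightarrow> real"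
  assumes "interlaced_space X p q"
    and "Metric_space.mcomplete X (pq_dist X p q)"
  shows
    "let L = pq_order X p q; T = Metric_space.mtopology X (pq_dist X p q); w = weight p in
      conditionally_monotone_complete TYPE('i) L \<and>
      compatible_topology TYPE('i) T L \<and>
      (\<forall>(I :: 'i set) r x. monotone_net L I r x \<longrightarrow>
        (let converges = (\<exists>l. limitin T x l (net_filter I r));
             has_supinf = (\<exists>s. is_supinf L I r x s);
             bounded_range = poset_bounded L (x ` I);
             bounded_weights = bounded (w ` x ` I);
             bounded_tail = (\<exists>i\<in>I. poset_bounded L (x ` tail I r i));
             bounded_tail_weights = (\<exists>i\<in>I. bounded (w ` x ` tail I r i))
         in
           ((converges \<longleftrightarrow> has_supinf) \<and>
            (has_supinf \<longleftrightarrow> bounded_tail) \<and>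
            (bounded_tail \<longleftrightarrow> bounded_tail_weights)) \<and>
           (bounded_range \<longrightarrow> bounded_weights) \<and>
           (bounded_weights \<longrightarrow> converges) \<and>
           (bounded_at_start L I r x \<longrightarrow>
             (converges \<longleftrightarrow> has_supinf) \<and>
             (has_supinf \<longleftrightarrow> bounded_range) \<and>
             (bounded_range \<longleftrightarrow> bounded_weights))))"
proof -
  interpret interlaced_space X p q
    by fact
  note complete = assms(2)
  have range: "x ` I \<subseteq> X" "x ` tail I r i \<subseteq> X" if "monotone_net L I r x" for I :: "'i set" and r x i
    using that by (auto simp: monotone_net_def tail_def)
  have "conditionally_monotone_complete TYPE('i) L"
    unfolding conditionally_monotone_complete_def
  proof (intro conjI allI impI partial_order_pq_order)
    fix I :: "'i set" and r x
    assume "monotone_net L I r x \<and> poset_bounded L (x ` I)"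
    then have net: "monotone_net L I r x" and "poset_bounded L (x ` I)"
      by auto
    then show "\<exists>s. is_supinf L I r x s"
      using converges_if_bounded_weights[OF complete net]
        bounded_weights_if_poset_bounded[OF range(1)[OF net]] supinf_iff_limit[OF complete net]
      by simp
  qed
  moreover have "compatible_topology TYPE('i) metric.mtopology L"
    unfolding compatible_topology_def using supinf_iff_limit[OF complete] by blast
  moreover
  {
    fix I :: "'i set" and r x
    assume net: "monotone_net L I r x"
    let ?converges = "\<exists>l. limitin metric.mtopology x l (net_filter I r)"
    \<comment> \<open>The implications form two cycles through \<open>?converges\<close>: one by way
      of a bounded tail and its weights, the other by way of the whole range and its weights. Only
      the second one, where it passes from convergence to a bounded range, uses
      \<open>bounded_at_start\<close>.\<close>
    have "?converges \<longleftrightarrow> (\<exists>s. is_supinf L I r x s)"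
      using supinf_iff_limit[OF complete net] by simp
    moreover have "?converges \<Longrightarrow> \<exists>i\<in>I. poset_bounded L (x ` tail I r i)"
      using bounded_tail_if_converges[OF net] by blast
    moreover have "\<exists>i\<in>I. poset_bounded L (x ` tail I r i) \<Longrightarrow>
        \<exists>i\<in>I. bounded (weight p ` x ` tail I r i)"
      using bounded_weights_if_poset_bounded[OF range(2)[OF net]] by blast
    moreover have "\<exists>i\<in>I. bounded (weight p ` x ` tail I r i) \<Longrightarrow> ?converges"
      using converges_if_bounded_tail_weights[OF complete net] by blast
    moreover have "poset_bounded L (x ` I) \<Longrightarrow> bounded (weight p ` x ` I)"
      using bounded_weights_if_poset_bounded[OF range(1)[OF net]] .
    moreover have "bounded (weight p ` x ` I) \<Longrightarrow> ?converges"
      using converges_if_bounded_weights[OF complete net] .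
    moreover have "bounded_at_start L I r x \<Longrightarrow> ?converges \<Longrightarrow> poset_bounded L (x ` I)"
      using poset_bounded_if_converges[OF net] by blast
    ultimately have "((?converges \<longleftrightarrow> (\<exists>s. is_supinf L I r x s)) \<and>
        ((\<exists>s. is_supinf L I r x s) \<longleftrightarrow> (\<exists>i\<in>I. poset_bounded L (x ` tail I r i))) \<and>
        ((\<exists>i\<in>I. poset_bounded L (x ` tail I r i)) \<longleftrightarrow>
          (\<exists>i\<in>I. bounded (weight p ` x ` tail I r i)))) \<and>
      (poset_bounded L (x ` I) \<longrightarrow> bounded (weight p ` x ` I)) \<and>
      (bounded (weight p ` x ` I) \<longrightarrow> ?converges) \<and>
      (bounded_at_start L I r x \<longrightarrow>
        (?converges \<longleftrightarrow> (\<exists>s. is_supinf L I r x s)) \<and>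
        ((\<exists>s. is_supinf L I r x s) \<longleftrightarrow> poset_bounded L (x ` I)) \<and>
        (poset_bounded L (x ` I) \<longleftrightarrow> bounded (weight p ` x ` I)))"
      by argo
  }
  ultimately show ?thesis
    unfolding Let_def by blast
qed

end
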